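(* Let $V$ be a finite-dimensional real vector space, let $\Gamma_1$ be a compact Lie group acting linearly on $V$ and endowed with an epimorphism $\sigma_1:\Gamma_1\to\{\pm1\}$, let $\mathbf{Z}_2^{\kappa}=\{1,\kappa\}$ be a group of order two acting linearly on $V$, and let $\Gamma_1\rtimes\mathbf{Z}_2^{\kappa}$ be a semidirect product acting on $V$ as described in the context, with $\sigma:\Gamma_1\rtimes\mathbf{Z}_2^{\kappa}\to\{\pm1\}$, $\sigma(\gamma_1,\gamma_2)=\sigma_1(\gamma_1)\sigma_2(\gamma_2)$, where $\sigma_2(\kappa)=-1$. Let $T:\vec{\mathcal{Q}}_{\sigma_1}(\Gamma_1)\to\vec{\mathcal{Q}}_{\sigma_1}(\Gamma_1)$ be the operator $T(G)=\frac12\left(G-\kappa G\kappa\right)$, that is, $T(G)(v)=\frac12\big(G(v)-\kappa\,G(\kappa v)\big)$ for $v\in V$. If $\vec{\mathcal{Q}}_{\sigma_1}(\Gamma_1)$ is a finitely generated module over $\mathcal{P}(\Gamma_1\rtimes\mathbf{Z}_2^{\kappa})$ with generators $G_1,\ldots,G_n$, then $\{T(G_i):1\le i\le n\}$ generates $\vec{\mathcal{Q}}_{\sigma}(\Gamma_1\rtimes\mathbf{Z}_2^{\kappa})$ over $\mathcal{P}(\Gamma_1\rtimes\mathbf{Z}_2^{\kappa})$.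
   Context: The semidirect product $\Gamma_1\rtimes\mathbf{Z}_2^{\kappa}$ is the set $\Gamma_1\times\mathbf{Z}_2^{\kappa}$ with operation $(\gamma_1,\gamma_2)(\tau_1,\tau_2)=(\gamma_1\,\mu(\gamma_2)\tau_1,\gamma_2\tau_2)$ for a homomorphism $\mu:\mathbf{Z}_2^{\kappa}\to\mathrm{Aut}(\Gamma_1)$. If $\rho$ and $\eta$ denote the representations of $\Gamma_1$ and $\mathbf{Z}_2^{\kappa}$ on $V$, it is assumed that $\rho(\mu(\gamma_2)(\gamma_1))=\eta(\gamma_2)\rho(\gamma_1)\eta(\gamma_2)^{-1}$ for all $\gamma_1,\gamma_2$, so that $(\gamma_1,\gamma_2)v=\rho(\gamma_1)(\eta(\gamma_2)v)$ is an action; $\rho(\gamma_1)$ and $\eta(\gamma_2)$ are written simply $\gamma_1$ and $\gamma_2$. It is assumed throughout that $\sigma_1(\mu(\gamma_2)\gamma_1)=\sigma_1(\gamma_1)$ for all $\gamma_1\in\Gamma_1$, $\gamma_2\in\mathbf{Z}_2^{\kappa}$ (so that $\sigma$ is a group homomorphism). For a group $G$ acting linearly on $V$ and a homomorphism $\tau:G\to\{\pm1\}$: $\mathcal{P}(G)$ is the ring of polynomial functions $f:V\to\mathbb{R}$ with $f(gv)=f(v)$ for all $g\in G$, $v\in V$; $\vec{\mathcal{Q}}_\tau(G)$ is the $\mathcal{P}(G)$-module of polynomial mappings $h:V\to V$ with $h(gv)=\tau(g)\,g\,h(v)$ for all $g\in G$, $v\in V$ (reversible-equivariants). $\vec{\mathcal{Q}}_{\sigma_1}(\Gamma_1)$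 is a module over $\mathcal{P}(\Gamma_1\rtimes\mathbf{Z}_2^{\kappa})$ because $\mathcal{P}(\Gamma_1\rtimes\mathbf{Z}_2^{\kappa})\subseteq\mathcal{P}(\Gamma_1)$. *)

theory Defs
  imports "HOL-Analysis.Analysis" "HOL-Algebra.Sym_Groups" "HOL-Algebra.Group_Action"
    "HOL-Algebra.Module"
begin

section \<open>Compact Lie groups\<close>

text \<open>Manifolds of dimension \<open>d\<close> are modelled on the topological space \<open>Euclidean_space d\<close>, whose
  points are the sequences vanishing from index \<open>d\<close> on.  This covers \<open>d = 0\<close>, hence finite groups.
  The sets \<open>U\<close> below are meant to be open in \<open>Euclidean_space d\<close>.\<close>

primrec Ck_on :: "nat \<Rightarrow> nat \<Rightarrow> (nat \<Rightarrow> real) set \<Rightarrow> ((nat \<Rightarrow> real) \<Rightarrow> real) \<Rightarrow> bool" where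
  "Ck_on d 0 U f \<longleftrightarrow> continuous_map (subtopology (Euclidean_space d) U) euclideanreal f"
| "Ck_on d (Suc k) U f \<longleftrightarrow>
     continuous_map (subtopology (Euclidean_space d) U) euclideanreal f \<and>
     (\<forall>i<d. \<exists>f'. (\<forall>x\<in>U. ((\<lambda>t. f (x(i := t))) has_real_derivative f' x) (at (x i))) \<and>
                 Ck_on d k U f')"

definition smooth_fun_on :: "nat \<Rightarrow> nat \<Rightarrow> (nat \<Rightarrow> real) set \<Rightarrow> ((nat \<Rightarrow> real) \<Rightarrow> nat \<Rightarrow> real) \<Rightarrow> bool"
  where "smooth_fun_on d e U f \<longleftrightarrow> (\<forall>j<e. \<forall>k. Ck_on d k U (\<lambda>x. f x j))"

type_synonym 'a chart = "'a set \<times> ('a \<Rightarrow> nat \<Rightarrow> real)"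

definition smooth_atlas :: "'a topology \<Rightarrow> nat \<Rightarrow> 'a chart set \<Rightarrow> bool" where
  "smooth_atlas X d A \<longleftrightarrow>
     topspace X = (\<Union>(U, \<phi>)\<in>A. U) \<and>
     (\<forall>(U, \<phi>)\<in>A. openin X U \<and> openin (Euclidean_space d) (\<phi> ` U) \<and>
        homeomorphic_map (subtopology X U) (subtopology (Euclidean_space d) (\<phi> ` U)) \<phi>) \<and>
     (\<forall>(U, \<phi>)\<in>A. \<forall>(W, \<psi>)\<in>A. smooth_fun_on d d (\<phi> ` (U \<inter> W)) (\<psi> \<circ> inv_into U \<phi>))"

definition smooth_map ::
  "'a topology \<Rightarrow> nat \<Rightarrow> 'a chart set \<Rightarrow> 'b topology \<Rightarrow> nat \<Rightarrow> 'b chart set \<Rightarrow> ('a \<Rightarrow> 'b) \<Rightarrow> bool" where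
  "smooth_map X d A Y e B f \<longleftrightarrow>
     continuous_map X Y f \<and>
     (\<forall>(U, \<phi>)\<in>A. \<forall>(W, \<psi>)\<in>B. smooth_fun_on d e (\<phi> ` (U \<inter> f -` W)) (\<psi> \<circ> f \<circ> inv_into U \<phi>))"

definition prod_atlas :: "nat \<Rightarrow> 'a chart set \<Rightarrow> 'b chart set \<Rightarrow> ('a \<times> 'b) chart set" where
  "prod_atlas d A B =
     {(U \<times> W, \<lambda>(a, b) i. if i < d then \<phi> a i else \<psi> b (i - d)) | U \<phi> W \<psi>. (U, \<phi>) \<in> A \<and> (W, \<psi>) \<in> B}"

text \<open>Second countability is automatic for compact spaces with a smooth atlas.\<close>

locale compact_lie_group = group G
  for G :: "('g, 'm) monoid_scheme" (structure) and X :: "'g topology" and d :: nat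
    and A :: "'g chart set" +
  assumes topspace_eq: "topspace X = carrier G"
    and compact: "compact_space X"
    and hausdorff: "Hausdorff_space X"
    and atlas: "smooth_atlas X d A"
    and smooth_mult:
      "smooth_map (prod_topology X X) (d + d) (prod_atlas d A A) X d A (\<lambda>(x, y). x \<otimes> y)"
    and smooth_inv: "smooth_map X d A X d A (\<lambda>x. inv x)"


section \<open>Linear actions and semidirect products\<close>

text \<open>As usual for Lie groups, an action is required to be continuous.  For a finite group with the
  discrete topology acting on a finite-dimensional space this is no restriction.\<close>

definition linear_action ::
  "('g, 'm) monoid_scheme \<Rightarrow> 'g topology \<Rightarrow> ('g \<Rightarrow> 'v \<Rightarrow> 'v::real_normed_vector) \<Rightarrow> bool" where
  "linear_action G X \<rho> \<longleftrightarrow>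
     group_action G UNIV \<rho> \<and>
     (\<forall>g\<in>carrier G. linear (\<rho> g)) \<and>
     continuous_map (prod_topology X euclidean) euclidean (\<lambda>(g, v). \<rho> g v)"

definition semidirect_product ::
  "('g, 'm) monoid_scheme \<Rightarrow> ('k, 'l) monoid_scheme \<Rightarrow> ('k \<Rightarrow> 'g \<Rightarrow> 'g) \<Rightarrow> ('g \<times> 'k) monoid" where
  "semidirect_product G K \<mu> =
     \<lparr>carrier = carrier G \<times> carrier K,
      mult = (\<lambda>(g, k) (h, l). (g \<otimes>\<^bsub>G\<^esub> \<mu> k h, k \<otimes>\<^bsub>K\<^esub> l)),
      one = (\<one>\<^bsub>G\<^esub>, \<one>\<^bsub>K\<^esub>)\<rparr>"

definition semidirect_action ::
  "('g \<Rightarrow> 'v \<Rightarrow> 'v) \<Rightarrow> ('k \<Rightarrow> 'v \<Rightarrow> 'v) \<Rightarrow> 'g \<times> 'k \<Rightarrow> 'v \<Rightarrow> 'v" where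
  "semidirect_action \<rho> \<eta> = (\<lambda>(g, k) v. \<rho> g (\<eta> k v))"

definition semidirect_sign :: "('g \<Rightarrow> int) \<Rightarrow> ('k \<Rightarrow> int) \<Rightarrow> 'g \<times> 'k \<Rightarrow> int" where
  "semidirect_sign \<sigma>\<^sub>1 \<sigma>\<^sub>2 = (\<lambda>(g, k). \<sigma>\<^sub>1 g * \<sigma>\<^sub>2 k)"


section \<open>Invariants and reversible-equivariants\<close>

definition invariant_ring ::
  "('g, 'm) monoid_scheme \<Rightarrow> ('g \<Rightarrow> 'v \<Rightarrow> 'v::real_normed_vector) \<Rightarrow> ('v \<Rightarrow> real) ring" where
  "invariant_ring G \<rho> =
     \<lparr>carrier = {f. real_polynomial_function f \<and> (\<forall>g\<in>carrier G. \<forall>v. f (\<rho> g v) = f v)},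
      mult = (\<lambda>p q v. p v * q v), one = (\<lambda>_. 1),
      zero = (\<lambda>_. 0), add = (\<lambda>p q v. p v + q v)\<rparr>"

text \<open>The fields \<open>mult\<close> and \<open>one\<close> of a module record carry no meaning.\<close>

definition equivariant_module ::
  "('g, 'm) monoid_scheme \<Rightarrow> ('g \<Rightarrow> 'v \<Rightarrow> 'v::real_normed_vector) \<Rightarrow> ('g \<Rightarrow> int) \<Rightarrow>
   ('v \<Rightarrow> real, 'v \<Rightarrow> 'v) module" where
  "equivariant_module G \<rho> \<tau> =
     \<lparr>carrier = {h. polynomial_function h \<and>
        (\<forall>g\<in>carrier G. \<forall>v. h (\<rho> g v) = of_int (\<tau> g) *\<^sub>R \<rho> g (h v))},
      mult = undefined, one = undefined,
      zero = (\<lambda>_. 0), add = (\<lambda>h k v. h v + k v),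
      smult = (\<lambda>p h v. p v *\<^sub>R h v)\<rparr>"

definition genmodule :: "('a, 'm) ring_scheme \<Rightarrow> ('a, 'b, 'n) module_scheme \<Rightarrow> 'b set \<Rightarrow> 'b set" where
  "genmodule R M S = \<Inter>{N. submodule N R M \<and> S \<subseteq> N}"

definition generates :: "('a, 'm) ring_scheme \<Rightarrow> ('a, 'b, 'n) module_scheme \<Rightarrow> 'b set \<Rightarrow> bool" where
  "generates R M S \<longleftrightarrow> S \<subseteq> carrier M \<and> genmodule R M S = carrier M"

definition reversing_operator ::
  "('v \<Rightarrow> 'v) \<Rightarrow> ('v \<Rightarrow> 'v) \<Rightarrow> 'v \<Rightarrow> 'v::real_vector" where
  "reversing_operator \<kappa> G = (\<lambda>v. (1 / 2) *\<^sub>R (G v - \<kappa> (G (\<kappa> v))))"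

section \<open>Well-definedness\<close>

lemma group_semidirect_product:
  assumes "group G" "group K" "\<mu> \<in> hom K (AutoGroup G)"
  shows "group (semidirect_product G K \<mu>)"
proof -
  interpret G: group G by fact
  interpret K: group K by fact
  have mu: "\<mu> k \<in> hom G G \<inter> Bij (carrier G)" if "k \<in> carrier K" for k
    using assms(3) that by (auto simp: hom_def AutoGroup_def auto_def)
  have mu_cl: "\<mu> k g \<in> carrier G" if "k \<in> carrier K" "g \<in> carrier G" for k g
    using mu[OF that(1)] that(2) by (auto simp: hom_def)
  have mu_mult: "\<mu> k (g \<otimes>\<^bsub>G\<^esub> h) = \<mu> k g \<otimes>\<^bsub>G\<^esub> \<mu> k h"
    if "k \<in> carrier K" "g \<in> carrier G" "h \<in> carrier G" for k g h
    using mu[OF that(1)] that by (auto simp: hom_def)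
  have mu_comp: "\<mu> (k \<otimes>\<^bsub>K\<^esub> l) g = \<mu> k (\<mu> l g)"
    if "k \<in> carrier K" "l \<in> carrier K" "g \<in> carrier G" for k l g
  proof -
    have "\<mu> (k \<otimes>\<^bsub>K\<^esub> l) = compose (carrier G) (\<mu> k) (\<mu> l)"
      using assms(3) mu[OF that(1)] mu[OF that(2)] that
      by (auto simp: hom_def AutoGroup_def BijGroup_def)
    then show ?thesis using that by (simp add: compose_def)
  qed
  have mu_one: "\<mu> \<one>\<^bsub>K\<^esub> g = g" if "g \<in> carrier G" for g
  proof -
    have inj: "inj_on (\<mu> \<one>\<^bsub>K\<^esub>) (carrier G)"
      using mu[of "\<one>\<^bsub>K\<^esub>"] by (auto simp: Bij_def bij_betw_def)
    have "\<mu> \<one>\<^bsub>K\<^esub> (\<mu> \<one>\<^bsub>K\<^esub> g) = \<mu> \<one>\<^bsub>K\<^esub> g"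
      using mu_comp[of "\<one>\<^bsub>K\<^esub>" "\<one>\<^bsub>K\<^esub>" g] that by simp
    then show ?thesis using inj_onD[OF inj] mu_cl that by simp
  qed
  show ?thesis
  proof (rule groupI)
    show "\<exists>y\<in>carrier (semidirect_product G K \<mu>).
        y \<otimes>\<^bsub>semidirect_product G K \<mu>\<^esub> x = \<one>\<^bsub>semidirect_product G K \<mu>\<^esub>"
      if "x \<in> carrier (semidirect_product G K \<mu>)" for x
    proof -
      obtain g k where x: "x = (g, k)" "g \<in> carrier G" "k \<in> carrier K"
        using \<open>x \<in> _\<close> by (auto simp: semidirect_product_def)
      show ?thesis
        using x mu_cl
        by (intro bexI[of _ "(inv\<^bsub>G\<^esub> (\<mu> (inv\<^bsub>K\<^esub> k) g), inv\<^bsub>K\<^esub> k)"]) (auto simp: semidirect_product_def)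
    qed
  qed (auto simp: semidirect_product_def mu_cl mu_mult mu_comp mu_one G.m_assoc K.m_assoc)
qed

lemma cring_invariant_ring: "cring (invariant_ring G \<rho>)"
proof (rule cringI)
  show "abelian_group (invariant_ring G \<rho>)"
  proof (rule abelian_groupI)
    fix p assume "p \<in> carrier (invariant_ring G \<rho>)"
    then show "\<exists>q\<in>carrier (invariant_ring G \<rho>). q \<oplus>\<^bsub>invariant_ring G \<rho>\<^esub> p = \<zero>\<^bsub>invariant_ring G \<rho>\<^esub>"
      by (intro bexI[of _ "\<lambda>v. - p v"]) (auto simp: invariant_ring_def)
  qed (auto simp: invariant_ring_def)
  show "comm_monoid (invariant_ring G \<rho>)"
    by (rule comm_monoidI) (auto simp: invariant_ring_def)
qed (auto simp: invariant_ring_def algebra_simps)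

lemma module_equivariant_module:
  assumes H: "linear_action H Y \<alpha>"
    and sub: "carrier (invariant_ring G \<rho>) \<subseteq> carrier (invariant_ring H \<alpha>)"
  shows "Module.module (invariant_ring G \<rho>) (equivariant_module H \<alpha> \<tau>)"
proof -
  have lin: "\<And>g. g \<in> carrier H \<Longrightarrow> linear (\<alpha> g)"
    using H by (auto simp: linear_action_def)
  show ?thesis
  proof (rule moduleI)
    show "cring (invariant_ring G \<rho>)" by (rule cring_invariant_ring)
    show "abelian_group (equivariant_module H \<alpha> \<tau>)"
    proof (rule abelian_groupI)
      fix h assume "h \<in> carrier (equivariant_module H \<alpha> \<tau>)"
      then show "\<exists>k\<in>carrier (equivariant_module H \<alpha> \<tau>).
          k \<oplus>\<^bsub>equivariant_module H \<alpha> \<tau>\<^esub> h = \<zero>\<^bsub>equivariant_module H \<alpha> \<tau>\<^esub>"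
        using lin by (intro bexI[of _ "\<lambda>v. - h v"]) (auto simp: equivariant_module_def linear_neg)
    qed (use lin in \<open>auto simp: equivariant_module_def linear_add linear_0 algebra_simps\<close>)
    fix p h assume ph: "p \<in> carrier (invariant_ring G \<rho>)" "h \<in> carrier (equivariant_module H \<alpha> \<tau>)"
    then have "p \<in> carrier (invariant_ring H \<alpha>)"
      using sub by blast
    with ph lin show "p \<odot>\<^bsub>equivariant_module H \<alpha> \<tau>\<^esub> h \<in> carrier (equivariant_module H \<alpha> \<tau>)"
      by (auto simp: equivariant_module_def invariant_ring_def real_polynomial_function_eq linear_scale)
  qed (auto simp: equivariant_module_def invariant_ring_def algebra_simps)
qed

end

theory Submission
  imports Defs
begin

text \<open>Write \<open>Q\<^sub>1\<close> for the reversible-equivariants of \<open>\<Gamma>\<^sub>1\<close> and \<open>Q\<close> for those of the semidirect product.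
  An element \<open>h\<close> of \<open>Q\<^sub>1\<close> lies in \<open>Q\<close> exactly if it anticommutes with the involution,
  \<open>h (\<kappa> v) = - \<kappa> (h v)\<close> (lemma \<open>carrier_equivariant_semidirect\<close>).  Equivalently, \<open>h\<close> is fixed by
  \<open>T\<close>, which averages \<open>h\<close> with \<open>- \<kappa> h \<kappa>\<close>.  Since conjugation by \<open>\<kappa>\<close> maps \<open>\<Gamma>\<^sub>1\<close> to itself and
  preserves signs, \<open>T\<close> maps \<open>Q\<^sub>1\<close> to itself (lemma \<open>reversing_operator_equivariant\<close>), and its values
  anticommute with \<open>\<kappa>\<close>.  So \<open>T\<close> is a projection of \<open>Q\<^sub>1\<close> onto \<open>Q\<close>.

  The invariants of the semidirect product are in particular unchanged by \<open>\<kappa>\<close>, so they may be pulled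
  out of \<open>T\<close>.  Hence \<open>T\<close> is a surjective map of modules over that ring, and such a map carries
  generators to generators (lemma \<open>generates_image\<close>).\<close>

section \<open>Generators under surjective module maps\<close>

lemma submodule_vimage:
  assumes M: "module R M" and N: "module R N"
    and hom: "t \<in> hom (add_monoid M) (add_monoid N)"
    and smult: "\<And>r x. r \<in> carrier R \<Longrightarrow> x \<in> carrier M \<Longrightarrow> t (r \<odot>\<^bsub>M\<^esub> x) = r \<odot>\<^bsub>N\<^esub> t x"
    and K: "submodule K R N"
  shows "submodule {x \<in> carrier M. t x \<in> K} R M"
proof -
  interpret M: Module.module R M by fact
  interpret N: Module.module R N by fact
  interpret K: submodule K R N by fact
  interpret t: group_hom "add_monoid M" "add_monoid N" t
    using hom by unfold_locales
  have neg: "t (\<ominus>\<^bsub>M\<^esub> x) = \<ominus>\<^bsub>N\<^esub> t x" if "x \<in> carrier M" for x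
    using t.hom_inv[of x] that by (simp add: a_inv_def)
  have add: "t (x \<oplus>\<^bsub>M\<^esub> y) = t x \<oplus>\<^bsub>N\<^esub> t y" if "x \<in> carrier M" "y \<in> carrier M" for x y
    using t.hom_mult that by simp
  have zero: "t \<zero>\<^bsub>M\<^esub> = \<zero>\<^bsub>N\<^esub>"
    using t.hom_one by simp
  show ?thesis
    using N.submoduleE[OF K] K.one_closed
    by (intro M.submoduleI) (auto simp: smult neg add zero)
qed

lemma submodule_genmodule_le:
  assumes "submodule K R M" "S \<subseteq> K"
  shows "genmodule R M S \<subseteq> K"
  using assms by (auto simp: genmodule_def)

text \<open>If the images of the generators lie in a submodule \<open>K\<close> of the target, then the preimage of
  \<open>K\<close> contains the generators, hence everything; surjectivity then forces \<open>K\<close> to be everything.\<close>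

lemma generates_image:
  assumes M: "module R M" and N: "module R N"
    and hom: "t \<in> hom (add_monoid M) (add_monoid N)"
    and smult: "\<And>r x. r \<in> carrier R \<Longrightarrow> x \<in> carrier M \<Longrightarrow> t (r \<odot>\<^bsub>M\<^esub> x) = r \<odot>\<^bsub>N\<^esub> t x"
    and surj: "carrier N \<subseteq> t ` carrier M"
    and gen: "generates R M S"
  shows "generates R N (t ` S)"
proof -
  interpret N: Module.module R N by fact
  have S: "S \<subseteq> carrier M" and spanS: "genmodule R M S = carrier M"
    using gen by (auto simp: generates_def)
  have tS: "t ` S \<subseteq> carrier N"
    using S hom by (auto simp: hom_def)
  have "carrier N \<subseteq> K" if K: "submodule K R N" "t ` S \<subseteq> K" for K
  proof -
    have "carrier M \<subseteq> {x \<in> carrier M. t x \<in> K}"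
      using submodule_genmodule_le[OF submodule_vimage[OF M N hom smult K(1)], of S] S K(2)
      by (auto simp: spanS)
    then show ?thesis
      using surj by blast
  qed
  then have "carrier N \<subseteq> genmodule R N (t ` S)"
    by (auto simp: genmodule_def)
  moreover have "genmodule R N (t ` S) \<subseteq> carrier N"
    by (rule submodule_genmodule_le[OF N.carrier_is_submodule tS])
  ultimately show ?thesis
    using tS by (simp add: generates_def)
qed


section \<open>The reversing operator of an involution\<close>

text \<open>Polynomial maps are built from bounded linear functionals, so composing with a linear map keeps
  them polynomial once that map is known to be bounded.  Boundedness comes from continuity of the
  action by the next lemma.\<close>

lemma bounded_linear_if_continuous:
  fixes f :: "'a::real_normed_vector \<Rightarrow> 'b::real_normed_vector"
  assumes "linear f" "isCont f 0"
  shows "bounded_linear f"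
proof -
  interpret linear f by fact
  obtain s where s: "s > 0" "\<And>x. dist x 0 < s \<Longrightarrow> dist (f x) (f 0) < 1"
    using assms(2) unfolding continuous_at_eps_delta by (metis zero_less_one)
  have "norm (f x) \<le> norm x * (2 / s)" for x
  proof (cases "x = 0")
    case False
    \<comment> \<open>rescale \<open>x\<close> to norm \<open>s / 2\<close>\<close>
    let ?c = "s / (2 * norm x)"
    have "norm (f (?c *\<^sub>R x)) < 1"
      using s(2)[of "?c *\<^sub>R x"] s(1) False by (simp add: zero)
    then have "?c * norm (f x) < 1"
      using s(1) False by (simp add: scale)
    then show ?thesis
      using s(1) False by (simp add: field_simps)
  qed (simp add: zero)
  then show ?thesis
    by (intro bounded_linear_intro[where K = "2 / s"]) (auto simp: add scale)
qed

lemma reversing_operator_add: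
  assumes "linear k"
  shows "reversing_operator k (\<lambda>v. h v + h' v) =
    (\<lambda>v. reversing_operator k h v + reversing_operator k h' v)"
  by (simp add: reversing_operator_def linear_add[OF assms] algebra_simps fun_eq_iff)

lemma reversing_operator_scale:
  assumes "linear k" "\<And>v. p (k v) = p v"
  shows "reversing_operator k (\<lambda>v. p v *\<^sub>R h v) = (\<lambda>v. p v *\<^sub>R reversing_operator k h v)"
  by (simp add: reversing_operator_def linear_scale[OF assms(1)] assms(2) algebra_simps fun_eq_iff)

lemma reversing_operator_fixes:
  assumes "linear k" "\<And>v. k (k v) = v" "\<And>v. h (k v) = - k (h v)"
  shows "reversing_operator k h = h"
  by (simp add: reversing_operator_def linear_neg[OF assms(1)] assms(2,3) fun_eq_iff
      flip: scaleR_2)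

lemma reversing_operator_anticommutes:
  assumes "linear k" "\<And>v. k (k v) = v"
  shows "reversing_operator k h (k v) = - k (reversing_operator k h v)"
  by (simp add: reversing_operator_def linear_diff[OF assms(1)] linear_scale[OF assms(1)] assms(2)
      flip: scaleR_minus_right)

text \<open>Conjugation by the involution permutes the group without changing signs; this is why it
  preserves the reversible-equivariant maps.\<close>

lemma reversing_operator_equivariant:
  assumes k: "bounded_linear k" "\<And>v. k (k v) = v"
    and lin: "\<And>g. g \<in> carrier G \<Longrightarrow> linear (\<rho> g)"
    and m: "\<And>g. g \<in> carrier G \<Longrightarrow> m g \<in> carrier G"
    and conj: "\<And>g v. g \<in> carrier G \<Longrightarrow> \<rho> (m g) v = k (\<rho> g (k v))"
    and sgn: "\<And>g. g \<in> carrier G \<Longrightarrow> \<tau> (m g) = \<tau> g"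
    and h: "h \<in> carrier (equivariant_module G \<rho> \<tau>)"
  shows "reversing_operator k h \<in> carrier (equivariant_module G \<rho> \<tau>)"
proof -
  note klin = bounded_linear.linear[OF k(1)]
  have poly: "polynomial_function h"
    and equi: "\<And>g v. g \<in> carrier G \<Longrightarrow> h (\<rho> g v) = of_int (\<tau> g) *\<^sub>R \<rho> g (h v)"
    using h by (auto simp: equivariant_module_def)
  have "polynomial_function (k \<circ> (h \<circ> k))"
    using poly polynomial_function_bounded_linear[OF k(1)] by blast
  then have "polynomial_function (reversing_operator k h)"
    using poly unfolding reversing_operator_def o_def
    by (intro polynomial_function_cmul polynomial_function_diff)
  moreover have "reversing_operator k h (\<rho> g v) = of_int (\<tau> g) *\<^sub>R \<rho> g (reversing_operator k h v)"
    if g: "g \<in> carrier G" for g v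
  proof -
    have "k (h (k (\<rho> g v))) = k (h (\<rho> (m g) (k v)))"
      by (simp add: conj[OF g] k(2))
    also have "\<dots> = of_int (\<tau> g) *\<^sub>R k (\<rho> (m g) (h (k v)))"
      by (simp only: equi[OF m[OF g]] sgn[OF g] linear_scale[OF klin])
    also have "\<dots> = of_int (\<tau> g) *\<^sub>R \<rho> g (k (h (k v)))"
      by (simp add: conj[OF g] k(2))
    finally have "k (h (k (\<rho> g v))) = of_int (\<tau> g) *\<^sub>R \<rho> g (k (h (k v)))" .
    then show ?thesis
      by (simp add: reversing_operator_def equi[OF g] linear_scale[OF lin[OF g]]
          linear_diff[OF lin[OF g]] algebra_simps)
  qed
  ultimately show ?thesis
    by (simp add: equivariant_module_def)
qed


section \<open>Semidirect products with a group of order two\<close>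

lemma linear_action_one:
  assumes "linear_action G X \<rho>" "group G"
  shows "\<rho> \<one>\<^bsub>G\<^esub> v = v"
proof -
  have "\<rho> \<one>\<^bsub>G\<^esub> = (\<lambda>x\<in>UNIV. x)"
    using assms group_action.id_eq_one unfolding linear_action_def by metis
  then show ?thesis by simp
qed

lemma linear_action_mult:
  assumes "linear_action G X \<rho>" "g \<in> carrier G" "h \<in> carrier G"
  shows "\<rho> (g \<otimes>\<^bsub>G\<^esub> h) v = \<rho> g (\<rho> h v)"
  using assms group_action.composition_rule[of G UNIV \<rho> v g h] unfolding linear_action_def by auto

lemma linear_action_bounded:
  assumes \<rho>: "linear_action G X \<rho>" and g: "g \<in> carrier G" and X: "topspace X = carrier G"
  shows "bounded_linear (\<rho> g)"
proof -
  have "continuous_map euclidean (prod_topology X euclidean) (\<lambda>v. (g, v))"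
    using g X by (simp add: continuous_map_pairedI)
  moreover have "continuous_map (prod_topology X euclidean) euclidean (\<lambda>(g, v). \<rho> g v)"
    using \<rho> by (simp add: linear_action_def)
  ultimately have "continuous_map euclidean euclidean (\<rho> g)"
    using continuous_map_compose by (fastforce simp: o_def)
  then have "continuous_on UNIV (\<rho> g)"
    by simp
  then have "isCont (\<rho> g) 0"
    using continuous_on_eq_continuous_at open_UNIV by blast
  then show ?thesis
    using \<rho> g by (intro bounded_linear_if_continuous) (auto simp: linear_action_def)
qed

text \<open>Equivariance under the product only needs testing on the two factors, since \<open>(g, k)\<close> acts as \<open>\<rho> g\<close>
  after \<open>\<eta> k\<close> and its sign is the product of the two signs.  For the factor of order two only the
  generator gives a condition.\<close>

lemma carrier_equivariant_semidirect:
  assumes one: "\<And>v. \<rho> \<one>\<^bsub>G\<^esub> v = v" "\<And>v. \<eta> \<one>\<^bsub>K\<^esub> v = v" "\<sigma>\<^sub>1 \<one>\<^bsub>G\<^esub> = 1" "\<sigma>\<^sub>2 \<one>\<^bsub>K\<^esub> = 1"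
    and G: "group G" and lin: "\<And>g. g \<in> carrier G \<Longrightarrow> linear (\<rho> g)"
    and K: "carrier K = {\<one>\<^bsub>K\<^esub>, \<kappa>}" "\<sigma>\<^sub>2 \<kappa> = -1"
  shows "carrier (equivariant_module (semidirect_product G K \<mu>) (semidirect_action \<rho> \<eta>)
      (semidirect_sign \<sigma>\<^sub>1 \<sigma>\<^sub>2)) =
    {h \<in> carrier (equivariant_module G \<rho> \<sigma>\<^sub>1). \<forall>v. h (\<eta> \<kappa> v) = - \<eta> \<kappa> (h v)}" (is "?L = ?R")
proof
  interpret G: group G by fact
  show "?L \<subseteq> ?R"
  proof
    fix h assume "h \<in> ?L"
    then have poly: "polynomial_function h"
      and equi: "\<And>g k v. g \<in> carrier G \<Longrightarrow> k \<in> carrier K \<Longrightarrow>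
        h (\<rho> g (\<eta> k v)) = of_int (\<sigma>\<^sub>1 g * \<sigma>\<^sub>2 k) *\<^sub>R \<rho> g (\<eta> k (h v))"
      by (auto simp: equivariant_module_def semidirect_product_def semidirect_action_def
          semidirect_sign_def)
    have "h (\<rho> g v) = of_int (\<sigma>\<^sub>1 g) *\<^sub>R \<rho> g (h v)" if "g \<in> carrier G" for g v
      using equi[OF that, of "\<one>\<^bsub>K\<^esub>" v] by (simp add: K one)
    moreover have "h (\<eta> \<kappa> v) = - \<eta> \<kappa> (h v)" for v
      using equi[OF G.one_closed, of \<kappa> v] by (simp add: K one)
    ultimately show "h \<in> ?R"
      using poly by (simp add: equivariant_module_def)
  qed
  show "?R \<subseteq> ?L"
    using lin
    by (auto simp: equivariant_module_def semidirect_product_def semidirect_action_def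
        semidirect_sign_def K one linear_neg)
qed

text \<open>It remains to extract from the hypotheses that \<open>\<kappa>\<close> acts as a bounded linear involution whose
  conjugation action on \<open>\<Gamma>\<^sub>1\<close> is \<open>\<mu> \<kappa>\<close>.\<close>

theorem theorem3p4:
  fixes \<Gamma>\<^sub>1 :: "('g, 'm) monoid_scheme" and X :: "'g topology" and d :: nat
    and \<A> :: "'g chart set"
    and Z2 :: "('k, 'l) monoid_scheme" and \<kappa> :: 'k
    and \<mu> :: "'k \<Rightarrow> 'g \<Rightarrow> 'g"
    and \<rho> :: "'g \<Rightarrow> 'v \<Rightarrow> 'v::real_normed_vector" and \<eta> :: "'k \<Rightarrow> 'v \<Rightarrow> 'v"
    and \<sigma>\<^sub>1 :: "'g \<Rightarrow> int" and \<sigma>\<^sub>2 :: "'k \<Rightarrow> int"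
    and G :: "nat \<Rightarrow> 'v \<Rightarrow> 'v" and n :: nat
  defines "\<Gamma> \<equiv> semidirect_product \<Gamma>\<^sub>1 Z2 \<mu>"
    and "\<alpha> \<equiv> semidirect_action \<rho> \<eta>"
    and "\<sigma> \<equiv> semidirect_sign \<sigma>\<^sub>1 \<sigma>\<^sub>2"
    and "T \<equiv> reversing_operator (\<eta> \<kappa>)"
  assumes finite_dim: "\<exists>B :: 'v set. finite B \<and> span B = UNIV"
    and Gamma1: "compact_lie_group \<Gamma>\<^sub>1 X d \<A>"
    and rho: "linear_action \<Gamma>\<^sub>1 X \<rho>"
    and sigma1: "\<sigma>\<^sub>1 \<in> epi \<Gamma>\<^sub>1 sign_img"
    and Z2: "group Z2" "carrier Z2 = {\<one>\<^bsub>Z2\<^esub>, \<kappa>}" "\<kappa> \<noteq> \<one>\<^bsub>Z2\<^esub>"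
    and eta: "linear_action Z2 (discrete_topology (carrier Z2)) \<eta>"
    and sigma2: "\<sigma>\<^sub>2 \<in> hom Z2 sign_img" "\<sigma>\<^sub>2 \<kappa> = -1"
    and mu: "\<mu> \<in> hom Z2 (AutoGroup \<Gamma>\<^sub>1)"
    and compatible: "\<And>g k. g \<in> carrier \<Gamma>\<^sub>1 \<Longrightarrow> k \<in> carrier Z2 \<Longrightarrow>
      \<rho> (\<mu> k g) = \<eta> k \<circ> \<rho> g \<circ> inv_into UNIV (\<eta> k)"
    and sigma1_mu: "\<And>g k. g \<in> carrier \<Gamma>\<^sub>1 \<Longrightarrow> k \<in> carrier Z2 \<Longrightarrow> \<sigma>\<^sub>1 (\<mu> k g) = \<sigma>\<^sub>1 g"
    and generators: "generates (invariant_ring \<Gamma> \<alpha>) (equivariant_module \<Gamma>\<^sub>1 \<rho> \<sigma>\<^sub>1) {G i | i. i \<in> {1..n}}"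
  shows "generates (invariant_ring \<Gamma> \<alpha>) (equivariant_module \<Gamma> \<alpha> \<sigma>) {T (G i) | i. i \<in> {1..n}}"
proof -
  let ?k = "\<eta> \<kappa>"
  let ?R = "invariant_ring \<Gamma> \<alpha>"
  let ?M = "equivariant_module \<Gamma>\<^sub>1 \<rho> \<sigma>\<^sub>1"
  let ?N = "equivariant_module \<Gamma> \<alpha> \<sigma>"
  interpret Gamma1: group \<Gamma>\<^sub>1
    using Gamma1 by (rule compact_lie_group.axioms)
  interpret Z2: group Z2 by fact
  have kappa: "\<kappa> \<in> carrier Z2"
    using Z2(2) by simp
  \<comment> \<open>The square of \<open>\<kappa>\<close> is \<open>\<one>\<close> or \<open>\<kappa>\<close>, and the latter would give \<open>\<kappa> = \<one>\<close> by cancellation.\<close>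
  have "\<kappa> \<otimes>\<^bsub>Z2\<^esub> \<kappa> \<noteq> \<kappa>"
    using Z2(3) kappa by simp
  then have kappa2: "\<kappa> \<otimes>\<^bsub>Z2\<^esub> \<kappa> = \<one>\<^bsub>Z2\<^esub>"
    using Z2.m_closed[OF kappa kappa] Z2(2) by blast
  have rho_one: "\<And>v. \<rho> \<one>\<^bsub>\<Gamma>\<^sub>1\<^esub> v = v" and eta_one: "\<And>v. \<eta> \<one>\<^bsub>Z2\<^esub> v = v"
    using linear_action_one[OF rho Gamma1.is_group] linear_action_one[OF eta Z2(1)] by auto
  have invol: "?k (?k v) = v" for v
    using linear_action_mult[OF eta kappa kappa] by (simp add: kappa2 eta_one)
  have bl: "bounded_linear ?k"
    by (rule linear_action_bounded[OF eta kappa]) simp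
  note lin = bounded_linear.linear[OF bl]
  have rho_lin: "\<And>g. g \<in> carrier \<Gamma>\<^sub>1 \<Longrightarrow> linear (\<rho> g)"
    using rho by (simp add: linear_action_def)
  have mu_closed: "\<mu> \<kappa> g \<in> carrier \<Gamma>\<^sub>1" if "g \<in> carrier \<Gamma>\<^sub>1" for g
    using mu kappa that by (auto simp: hom_def AutoGroup_def auto_def)
  have "inv_into UNIV ?k = ?k"
    by (rule inv_equality) (simp_all add: invol)
  then have conj: "\<rho> (\<mu> \<kappa> g) v = ?k (\<rho> g (?k v))" if "g \<in> carrier \<Gamma>\<^sub>1" for g v
    using compatible[OF that kappa] by simp
  have "\<sigma>\<^sub>1 \<one>\<^bsub>\<Gamma>\<^sub>1\<^esub> = \<one>\<^bsub>sign_img\<^esub>" "\<sigma>\<^sub>2 \<one>\<^bsub>Z2\<^esub> = \<one>\<^bsub>sign_img\<^esub>"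
    using sigma1 sigma2(1) hom_one[OF _ _ sign_img_is_group] Gamma1.is_group Z2(1)
    by (auto simp: epi_def)
  then have sgn_one: "\<sigma>\<^sub>1 \<one>\<^bsub>\<Gamma>\<^sub>1\<^esub> = 1" "\<sigma>\<^sub>2 \<one>\<^bsub>Z2\<^esub> = 1"
    by (simp_all add: sign_img_def)
  have carrier_N: "carrier ?N = {h \<in> carrier ?M. \<forall>v. h (?k v) = - ?k (h v)}"
    unfolding \<Gamma>_def \<alpha>_def \<sigma>_def
    by (rule carrier_equivariant_semidirect)
      (use rho_one eta_one sgn_one Gamma1.is_group rho_lin Z2(2) sigma2(2) in auto)
  have R_inv: "p (\<rho> g (\<eta> k v)) = p v"
    if "p \<in> carrier ?R" "g \<in> carrier \<Gamma>\<^sub>1" "k \<in> carrier Z2" for p g k v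
    using that
    by (auto simp: \<Gamma>_def \<alpha>_def invariant_ring_def semidirect_product_def semidirect_action_def)
  have R_kappa: "p (?k v) = p v" if "p \<in> carrier ?R" for p v
    using R_inv[OF that Gamma1.one_closed kappa] by (simp add: rho_one)
  have "p (\<rho> g v) = p v" if "p \<in> carrier ?R" "g \<in> carrier \<Gamma>\<^sub>1" for p g v
    using R_inv[OF that Z2.one_closed] by (simp add: eta_one)
  then have "carrier ?R \<subseteq> carrier (invariant_ring \<Gamma>\<^sub>1 \<rho>)"
    by (auto simp: invariant_ring_def)
  then have M: "module ?R ?M"
    by (rule module_equivariant_module[OF rho])
  interpret M: Module.module ?R ?M by fact
  have zero_fun: "\<zero>\<^bsub>?M\<^esub> = (\<lambda>_. 0)" and add_fun: "\<And>h h'. h \<oplus>\<^bsub>?M\<^esub> h' = (\<lambda>v. h v + h' v)"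
    and smult_fun: "\<And>p h. p \<odot>\<^bsub>?M\<^esub> h = (\<lambda>v. p v *\<^sub>R h v)"
    by (simp_all add: equivariant_module_def)
  have neg_fun: "\<ominus>\<^bsub>?M\<^esub> h = (\<lambda>v. - h v)" if "h \<in> carrier ?M" for h
    using M.l_neg[OF that] by (auto simp: zero_fun add_fun fun_eq_iff eq_neg_iff_add_eq_0)
  \<comment> \<open>The module axioms for \<open>?N\<close> are inherited: it has the operations of \<open>?M\<close> on a smaller carrier.\<close>
  have "submodule (carrier ?N) ?R ?M"
    unfolding carrier_N
  proof (rule M.submoduleI)
    show "\<ominus>\<^bsub>?M\<^esub> h \<in> {h \<in> carrier ?M. \<forall>v. h (?k v) = - ?k (h v)}"
      if "h \<in> {h \<in> carrier ?M. \<forall>v. h (?k v) = - ?k (h v)}" for h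
      using that M.a_inv_closed[of h] by (auto simp: neg_fun linear_neg[OF lin])
  qed (use M.a_closed M.smult_closed M.zero_closed in
      \<open>auto simp: zero_fun add_fun smult_fun R_kappa linear_0[OF lin] linear_add[OF lin]
        linear_scale[OF lin]\<close>)
  then have "module ?R (?M\<lparr>carrier := carrier ?N\<rparr>)"
    using M by (rule submodule.submodule_is_module)
  moreover have "?M\<lparr>carrier := carrier ?N\<rparr> = ?N"
    by (simp add: equivariant_module_def)
  ultimately have N: "module ?R ?N"
    by simp
  have T_closed: "T h \<in> carrier ?N" if "h \<in> carrier ?M" for h
    unfolding carrier_N T_def
    using reversing_operator_equivariant[where m = "\<mu> \<kappa>", OF bl invol rho_lin mu_closed conj _ that]
      reversing_operator_anticommutes[OF lin invol] sigma1_mu kappa by blast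
  have "generates ?R ?N (T ` {G i | i. i \<in> {1..n}})"
  proof (rule generates_image[OF M N _ _ _ generators])
    show "T \<in> hom (add_monoid ?M) (add_monoid ?N)"
      using T_closed reversing_operator_add[OF lin]
      by (auto simp: hom_def T_def equivariant_module_def)
    show "T (p \<odot>\<^bsub>?M\<^esub> h) = p \<odot>\<^bsub>?N\<^esub> T h" if "p \<in> carrier ?R" for p h
      using reversing_operator_scale[OF lin, of p h] R_kappa[OF that]
      by (simp add: T_def equivariant_module_def)
    have "h = T h" if "h \<in> carrier ?N" for h
      using that unfolding carrier_N T_def
      by (simp add: reversing_operator_fixes[OF lin invol])
    then show "carrier ?N \<subseteq> T ` carrier ?M"
      using carrier_N by blast
  qed
  moreover have "T ` {G i | i. i \<in> {1..n}} = {T (G i) | i. i \<in> {1..n}}"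
    by blast
  ultimately show ?thesis
    by simp
qed

end
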